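(* Let $K$ be an arbitrary field and let $R$ be a finitely generated graded algebra over $K$ of finite Gelfand-Kirillov dimension. Then the Hilbert series $H(R,t)$ is either a rational function or transcendental over $\mathbb{Q}(t)$.
   Context: Algebras are unitary associative algebras over a field $K$ of any characteristic. A graded algebra is an algebra $R$ that is a direct sum of vector subspaces $R=R_0\oplus R_1\oplus R_2\oplus\cdots$ with $R_mR_n\subset R_{m+n}$ for all $m,n\geq 0$; it is assumed throughout that $R_0=0$ or $R_0=K$ and that the (finitely many) algebra generators of $R$ are of first degree. The Hilbert series of $R$ is the formal power series $H(R,t)=\sum_{n\geq 0}\dim_K(R_n)\,t^n$. A power series is rational if it is the expansion of an element of $\mathbb{Q}(t)$; it is algebraic (respectively transcendental) if it is algebraic (respectively not algebraic) over $\mathbb{Q}(t)$. If $R$ is generated by a finite dimensional vector space $V$, its growth function is $g_V(n)=\dim(V^0+V^1+\cdots+V^n)$, $n=0,1,2,\ldots$ (with $V^0=K$), and the Gelfand-Kirillov dimension of $R$ is $\mathrm{GKdim}(R)=\limsup_{n\to\infty}\log_n(g_V(n))$, which does not depend on the choice of $V$. *)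

theory Defs
  imports
    "HOL-Analysis.Analysis"
    "HOL-Computational_Algebra.Formal_Laurent_Series"
    "HOL-Computational_Algebra.Polynomial_FPS"
begin

(* The carrier has class ring, without a unit: a graded algebra with zero component in degree 0
   is not unitary unless it is zero. *)
locale algebra_over = vector_space scale
  for scale :: "'k::field \<Rightarrow> 'a::ring \<Rightarrow> 'a" +
  assumes scale_mult_left: "scale c (x * y) = scale c x * y"
    and scale_mult_right: "scale c (x * y) = x * scale c y"
begin

(* {1} if the algebra is unitary and nonzero, and {} otherwise. *)
definition unity :: "'a set" where
  "unity = {e. e \<noteq> 0 \<and> (\<forall>x. e * x = x \<and> x * e = x)}"

definition subalgebra :: "'a set \<Rightarrow> bool" where
  "subalgebra S \<longleftrightarrow> subspace S \<and> unity \<subseteq> S \<and> (\<forall>x\<in>S. \<forall>y\<in>S. x * y \<in> S)"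

definition generates :: "'a set \<Rightarrow> bool" where
  "generates X \<longleftrightarrow> \<Inter> {S. subalgebra S \<and> X \<subseteq> S} = UNIV"

definition finite_dim :: "'a set \<Rightarrow> bool" where
  "finite_dim V \<longleftrightarrow> (\<exists>B. finite B \<and> span B = V)"

definition generating_space :: "'a set \<Rightarrow> bool" where
  "generating_space V \<longleftrightarrow> finite_dim V \<and> generates V"

(* The power 0 is the line K 1 in the unitary case and 0 otherwise. *)
fun space_power :: "'a set \<Rightarrow> nat \<Rightarrow> 'a set" where
  "space_power V 0 = span unity"
| "space_power V (Suc 0) = span V"
| "space_power V (Suc (Suc n)) = span {x * y | x y. x \<in> space_power V (Suc n) \<and> y \<in> V}"

(* The convention V^0 = K is kept if the algebra has no (nonzero) unit; the line K
   is then not part of the algebra and contributes the additional dimension 1. *)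
definition growth :: "'a set \<Rightarrow> nat \<Rightarrow> nat" where
  "growth V n = dim (span (\<Union>i\<le>n. space_power V i)) + (if unity = {} then 1 else 0)"

definition GKdim_wrt :: "'a set \<Rightarrow> ereal" where
  "GKdim_wrt V = limsup (\<lambda>n. ereal (log (real n) (real (growth V n))))"

(* Existence and independence of the choice of V: lemmas generating_space_span and GKdim_eq. *)
definition GKdim :: ereal where
  "GKdim = GKdim_wrt (SOME V. generating_space V)"

end

locale graded_algebra = algebra_over scale
  for scale :: "'k::field \<Rightarrow> 'a::ring \<Rightarrow> 'a" +
  fixes R :: "nat \<Rightarrow> 'a set"
  assumes subspace_component: "subspace (R n)"
    and direct_sum: "\<exists>!f. (\<forall>n. f n \<in> R n) \<and> finite {n. f n \<noteq> 0} \<and> x = (\<Sum>n | f n \<noteq> 0. f n)"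
    and mult_component: "x \<in> R m \<Longrightarrow> y \<in> R n \<Longrightarrow> x * y \<in> R (m + n)"
    and component_0: "R 0 = {0} \<or> (\<exists>e\<in>unity. R 0 = span {e})"
begin

definition Hilbert_series :: "rat fps" where
  "Hilbert_series = Abs_fps (\<lambda>n. of_nat (dim (R n)))"

end

locale fg_graded_algebra = graded_algebra +
  assumes finitely_generated_degree_1: "\<exists>X. finite X \<and> X \<subseteq> R 1 \<and> generates X"

(* The field Q(t), as a subfield of the field Q((t)) of formal Laurent series. *)
definition rational_functions :: "rat fls set" where
  "rational_functions =
     {fps_to_fls (fps_of_poly p) / fps_to_fls (fps_of_poly q) | p q. q \<noteq> 0}"

definition rational_series :: "rat fps \<Rightarrow> bool" where
  "rational_series f \<longleftrightarrow> fps_to_fls f \<in> rational_functions"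

definition algebraic_series :: "rat fps \<Rightarrow> bool" where
  "algebraic_series f \<longleftrightarrow>
     (\<exists>P. (\<forall>i. coeff P i \<in> rational_functions) \<and> P \<noteq> 0 \<and> poly P (fps_to_fls f) = 0)"

abbreviation transcendental_series :: "rat fps \<Rightarrow> bool" where
  "transcendental_series f \<equiv> \<not> algebraic_series f"

context algebra_over
begin

lemma generating_space_span:
  assumes "finite X" "generates X" shows "generating_space (span X)"
proof -
  have "S = UNIV" if "subalgebra S" "span X \<subseteq> S" for S
  proof -
    have "X \<subseteq> S" using span_superset that(2) by (rule subset_trans)
    with that(1) have "\<Inter> {S. subalgebra S \<and> X \<subseteq> S} \<subseteq> S" by (intro Inter_lower) simp
    then show ?thesis unfolding assms(2)[unfolded generates_def] by (rule top.extremum_uniqueI)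
  qed
  then have "generates (span X)" unfolding generates_def by (intro equalityI subset_UNIV) auto
  with assms(1) show ?thesis unfolding generating_space_def finite_dim_def by blast
qed

lemma unity_mult: "u \<in> unity \<Longrightarrow> u * x = x" "u \<in> unity \<Longrightarrow> x * u = x"
  unfolding unity_def by blast+

lemma unity_unique:
  assumes "u \<in> unity" shows "unity = {u}"
proof -
  have "v = u" if "v \<in> unity" for v
    using unity_mult(1)[OF assms, of v] unity_mult(2)[OF that, of u] by simp
  then show ?thesis using assms by blast
qed

lemma finite_unity: "finite unity"
proof (cases "unity = {}")
  case False
  then obtain u where "u \<in> unity" by blast
  then have "unity = {u}" by (rule unity_unique)
  then show ?thesis by (metis finite.emptyI finite.insertI)
qed simp

lemma span_mult:
  assumes "\<And>a b. a \<in> A \<Longrightarrow> b \<in> B \<Longrightarrow> a * b \<in> span C" "x \<in> span A" "y \<in> span B"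
  shows "x * y \<in> span C"
proof -
  have 1: "a * y \<in> span C" if "a \<in> A" for a
    using \<open>y \<in> span B\<close>
  proof (induction rule: span_induct_alt)
    case base show ?case by (simp add: span_zero)
  next
    case (step c z w)
    then show ?case using assms(1)[OF that, of z]
      by (simp add: distrib_left scale_mult_right[symmetric] span_add span_scale)
  qed
  show ?thesis using \<open>x \<in> span A\<close>
  proof (induction rule: span_induct_alt)
    case base show ?case by (simp add: span_zero)
  next
    case (step c z w)
    then show ?case using 1[of z]
      by (simp add: distrib_right scale_mult_left[symmetric] span_add span_scale)
  qed
qed

lemma subspace_space_power: "subspace (space_power V n)"
  by (induction V n rule: space_power.induct) auto

lemma span_space_power: "span (space_power V n) = space_power V n"
  using subspace_space_power by (simp add: span_eq_iff)

lemma space_power_Suc_mem: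
  assumes "x \<in> space_power V n" "y \<in> V"
  shows "x * y \<in> space_power V (Suc n)"
proof (cases n)
  case 0
  have "x * y \<in> span V"
  proof (rule span_mult[of unity "{y}"])
    fix a b assume "a \<in> unity" "b \<in> {y}"
    then show "a * b \<in> span V" using assms(2) by (simp add: unity_mult span_base)
  qed (use assms 0 in \<open>auto simp: span_base\<close>)
  then show ?thesis using 0 by simp
next
  case (Suc m)
  then show ?thesis using assms by (auto intro!: span_base)
qed

lemma space_power_mult:
  "x \<in> space_power V m \<Longrightarrow> y \<in> space_power V n \<Longrightarrow> x * y \<in> space_power V (m + n)"
proof (induction V n arbitrary: x y rule: space_power.induct)
  case (1 V)
  have "x * y \<in> span (space_power V m)"
  proof (rule span_mult)
    show "x \<in> span {x}" by (simp add: span_base)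
    show "y \<in> span unity" using "1.prems"(2) by simp
  next
    fix a b assume "a \<in> {x}" "b \<in> unity"
    then show "a * b \<in> span (space_power V m)"
      using "1.prems"(1) unity_mult(2)[of b x] by (simp add: span_base)
  qed
  then show ?case by (simp add: span_space_power)
next
  case (2 V)
  have "x * y \<in> span (space_power V (Suc m))"
  proof (rule span_mult)
    show "x \<in> span (space_power V m)" using "2.prems"(1) by (rule span_base)
    show "y \<in> span V" using "2.prems"(2) by simp
  qed (intro span_base space_power_Suc_mem)
  then show ?case by (simp add: span_space_power)
next
  case (3 V n)
  let ?D = "{x * y | x y. x \<in> space_power V (Suc n) \<and> y \<in> V}"
  have "x * y \<in> span (space_power V (m + Suc (Suc n)))"
  proof (rule span_mult)
    show "x \<in> span {x}" by (simp add: span_base)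
    show "y \<in> span ?D" using "3.prems"(2) by simp
  next
    fix a b assume "a \<in> {x}" "b \<in> ?D"
    then obtain z v where zv: "a = x" "b = z * v" "z \<in> space_power V (Suc n)" "v \<in> V" by blast
    have "x * z \<in> space_power V (m + Suc n)" by (rule "3.IH"[OF "3.prems"(1) zv(3)])
    from space_power_Suc_mem[OF this zv(4)] show "a * b \<in> span (space_power V (m + Suc (Suc n)))"
      by (simp only: zv(1,2) span_space_power mult.assoc add_Suc_right)
  qed
  then show ?case by (simp only: span_space_power)
qed

definition filtration :: "'a set \<Rightarrow> nat \<Rightarrow> 'a set" where
  "filtration V n = span (\<Union>i\<le>n. space_power V i)"

lemma growth_filtration: "growth V n = dim (filtration V n) + (if unity = {} then 1 else 0)"
  by (simp add: growth_def filtration_def)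

lemma span_filtration [simp]: "span (filtration V n) = filtration V n"
  by (simp add: filtration_def)

lemma filtration_mono: "m \<le> n \<Longrightarrow> filtration V m \<subseteq> filtration V n"
  unfolding filtration_def by (rule span_mono) force

lemma space_power_filtration: "i \<le> n \<Longrightarrow> space_power V i \<subseteq> filtration V n"
  unfolding filtration_def using span_superset by fastforce

lemma filtration_mult:
  assumes "x \<in> filtration V m" "y \<in> filtration V n"
  shows "x * y \<in> filtration V (m + n)"
proof -
  have "x * y \<in> span (filtration V (m + n))"
  proof (rule span_mult)
    fix a b assume "a \<in> (\<Union>i\<le>m. space_power V i)" "b \<in> (\<Union>i\<le>n. space_power V i)"
    then obtain i j where "i \<le> m" "j \<le> n" "a \<in> space_power V i" "b \<in> space_power V j" by auto
    with space_power_mult[of a V i b j] space_power_filtration[of "i + j" "m + n" V]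
    show "a * b \<in> span (filtration V (m + n))" by auto
  qed (use assms in \<open>auto simp: filtration_def\<close>)
  then show ?thesis by simp
qed

lemma finite_span_mult:
  assumes "finite B" "finite C"
  shows "\<exists>D. finite D \<and> span {x * y | x y. x \<in> span C \<and> y \<in> span B} = span D"
proof (intro exI conjI)
  let ?D = "(\<lambda>(x, y). x * y) ` (C \<times> B)"
  let ?S = "{x * y | x y. x \<in> span C \<and> y \<in> span B}"
  show "finite ?D" using assms by (intro finite_imageI finite_cartesian_product)
  have D: "a * b \<in> span ?D" if "a \<in> C" "b \<in> B" for a b
    by (rule span_base) (use that in force)
  have "?S \<subseteq> span ?D"
  proof
    fix z assume "z \<in> ?S"
    then obtain x y where z: "z = x * y" "x \<in> span C" "y \<in> span B" by blast
    show "z \<in> span ?D" unfolding z(1) by (rule span_mult[OF D z(2,3)])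
  qed
  moreover have "?D \<subseteq> span ?S"
  proof
    fix z assume "z \<in> ?D"
    then obtain x y where z: "z = x * y" "x \<in> C" "y \<in> B" by auto
    have "x \<in> span C" "y \<in> span B" using z(2,3) by (simp_all add: span_base)
    then have "z \<in> ?S" using z(1) by blast
    then show "z \<in> span ?S" by (rule span_base)
  qed
  ultimately show "span ?S = span ?D" unfolding span_eq ..
qed

lemma finite_span_space_power:
  assumes "finite B" shows "\<exists>C. finite C \<and> space_power (span B) n = span C"
proof (induction n rule: less_induct)
  case (less n)
  consider "n = 0" | "n = 1" | k where "n = Suc (Suc k)"
    by (metis One_nat_def not0_implies_Suc)
  then show ?case
  proof cases
    case 1
    show ?thesis unfolding 1 space_power.simps by (intro exI[of _ unity] conjI finite_unity refl)
  next
    case 2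
    show ?thesis unfolding 2 One_nat_def space_power.simps span_span
      by (intro exI[of _ B] conjI assms refl)
  next
    case 3
    obtain C where C: "finite C" "space_power (span B) (Suc k) = span C"
      using less[of "Suc k"] 3 by auto
    show ?thesis unfolding 3 space_power.simps C(2) by (rule finite_span_mult[OF assms C(1)])
  qed
qed

lemma finite_span_filtration:
  assumes "finite_dim V" shows "\<exists>C. finite C \<and> filtration V n = span C"
proof -
  obtain B where B: "finite B" "V = span B" using assms unfolding finite_dim_def by blast
  obtain C where C: "\<And>i. finite (C i)" "\<And>i. space_power V i = span (C i)"
    using finite_span_space_power[OF B(1)] unfolding B(2) by metis
  have "filtration V n = span (\<Union>i\<le>n. C i)"
    unfolding filtration_def span_eq C(2)
  proof
    show "(\<Union>i\<le>n. span (C i)) \<subseteq> span (\<Union>i\<le>n. C i)"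
      by (intro UN_least span_mono) blast
    have "(\<Union>i\<le>n. C i) \<subseteq> (\<Union>i\<le>n. span (C i))" by (intro UN_mono order_refl span_superset)
    also have "\<dots> \<subseteq> span \<dots>" by (rule span_superset)
    finally show "(\<Union>i\<le>n. C i) \<subseteq> span (\<Union>i\<le>n. span (C i))" .
  qed
  moreover have "finite (\<Union>i\<le>n. C i)" using C(1) by blast
  ultimately show ?thesis by blast
qed

lemma dim_mono_finite:
  assumes "A \<subseteq> span C" "finite C" shows "dim A \<le> dim (span C)"
proof -
  obtain D where D: "D \<subseteq> C" "independent D" "C \<subseteq> span D" using maximal_independent_subset by metis
  have "span D = span C" unfolding span_eq using D span_superset[of C] by blast
  moreover have "finite D" using D(1) assms(2) by (rule finite_subset)
  moreover have "dim (span D) = card D" using D dim_span_eq_card_independent by auto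
  ultimately show ?thesis using dim_le_card[of A D] assms by auto
qed

lemma growth_mono_filtration:
  assumes "finite_dim V" "filtration W m \<subseteq> filtration V n"
  shows "growth W m \<le> growth V n"
  using finite_span_filtration[OF assms(1), of n] dim_mono_finite assms(2)
  by (auto simp: growth_filtration)

lemma filtration_exhausts:
  assumes "generates V" shows "\<exists>n. x \<in> filtration V n"
proof -
  let ?S = "\<Union>n. filtration V n"
  have sup: "\<exists>k. x \<in> filtration V k \<and> y \<in> filtration V k"
    if "x \<in> filtration V m" "y \<in> filtration V n" for x y m n
    using that filtration_mono[of m "max m n" V] filtration_mono[of n "max m n" V] by auto
  have sub: "subspace (filtration V n)" for n unfolding filtration_def by simp
  have "subspace ?S"
    unfolding subspace_def
  proof (intro conjI ballI allI)
    show "0 \<in> ?S" using sub subspace_0 by blast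
  next
    fix x y assume "x \<in> ?S" "y \<in> ?S"
    then obtain k where "x \<in> filtration V k" "y \<in> filtration V k" using sup by blast
    then show "x + y \<in> ?S" using subspace_add[OF sub] by blast
  next
    fix c x assume "x \<in> ?S"
    then show "scale c x \<in> ?S" using subspace_scale[OF sub] by blast
  qed
  moreover have "unity \<subseteq> ?S"
    using space_power_filtration[of 0 0 V] span_superset[of unity] by auto
  moreover have "V \<subseteq> ?S"
    using space_power_filtration[of 1 1 V] span_superset[of V] by auto
  moreover have "x * y \<in> ?S" if "x \<in> ?S" "y \<in> ?S" for x y
    using that filtration_mult by blast
  ultimately have "subalgebra ?S" "V \<subseteq> ?S" unfolding subalgebra_def by auto
  then show ?thesis using assms unfolding generates_def by blast
qed

lemma filtration_cover:
  assumes "generates V" "finite_dim W" shows "\<exists>m>0. W \<subseteq> filtration V m"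
proof -
  obtain B where B: "finite B" "W = span B" using assms(2) by (auto simp: finite_dim_def)
  obtain f where f: "\<And>x. x \<in> filtration V (f x)" using filtration_exhausts[OF assms(1)] by metis
  define m where "m = Suc (Max (insert 0 (f ` B)))"
  have "f x \<le> m" if "x \<in> B" for x
    using that B(1) by (auto simp: m_def intro!: le_SucI Max_ge)
  then have "B \<subseteq> filtration V m" using f filtration_mono[of _ m V] by blast
  then have "W \<subseteq> filtration V m" unfolding B(2) by (metis span_filtration span_mono)
  then show ?thesis by (intro exI[of _ m]) (simp add: m_def)
qed

lemma space_power_cover:
  assumes "W \<subseteq> filtration V m" shows "space_power W n \<subseteq> filtration V (m * n)"
proof (induction n rule: less_induct)
  case (less n)
  consider "n = 0" | "n = 1" | k where "n = Suc (Suc k)"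
    by (metis One_nat_def not0_implies_Suc)
  then show ?case
  proof cases
    case 1
    then show ?thesis using space_power_filtration[of 0 0 V] by simp
  next
    case 2
    then show ?thesis using span_mono[OF assms] by simp
  next
    case 3
    have "x * y \<in> filtration V (m * n)" if "x \<in> space_power W (Suc k)" "y \<in> W" for x y
    proof -
      have "x \<in> filtration V (m * Suc k)" using less[of "Suc k"] 3 that by auto
      with filtration_mult[of x V "m * Suc k" y m] that assms 3 show ?thesis
        by (auto simp: algebra_simps)
    qed
    then have "{x * y | x y. x \<in> space_power W (Suc k) \<and> y \<in> W} \<subseteq> filtration V (m * n)" by auto
    from span_mono[OF this] show ?thesis using 3 by simp
  qed
qed

lemma filtration_cover_mult:
  assumes "W \<subseteq> filtration V m" shows "filtration W n \<subseteq> filtration V (m * n)"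
proof -
  have "space_power W i \<subseteq> filtration V (m * n)" if "i \<le> n" for i
    using space_power_cover[OF assms, of i] filtration_mono[of "m * i" "m * n" V] that by auto
  then have "(\<Union>i\<le>n. space_power W i) \<subseteq> filtration V (m * n)" by blast
  from span_mono[OF this] show ?thesis by (simp add: filtration_def span_span)
qed

lemma growth_pos:
  assumes "finite_dim V" shows "0 < growth V n"
proof (cases "unity = {}")
  case False
  then obtain u where u: "unity = {u}" using unity_unique by blast
  then have "u \<noteq> 0" by (auto simp: unity_def)
  then have "independent {u}" by simp
  then have "dim (span {u}) = 1" using dim_span_eq_card_independent[of "{u}"] by simp
  moreover have "span {u} \<subseteq> filtration V n" using space_power_filtration[of 0 n V] u by simp
  moreover obtain C where "finite C" "filtration V n = span C"
    using finite_span_filtration[OF assms] by blast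
  ultimately have "1 \<le> dim (filtration V n)"
    using dim_mono_finite[of "span {u}" C] by simp
  then show ?thesis by (simp add: growth_filtration)
qed (simp add: growth_def)

lemma GKdim_wrt_le:
  assumes V: "generating_space V" and W: "generating_space W"
  shows "GKdim_wrt W \<le> GKdim_wrt V"
proof (rule ereal_le_real)
  fix c' :: real assume le: "GKdim_wrt V \<le> ereal c'"
  have fV: "finite_dim V" "generates V" and fW: "finite_dim W"
    using V W by (auto simp: generating_space_def)
  obtain m where m: "m > 0" "W \<subseteq> filtration V m" using filtration_cover[OF fV(2) fW] by auto
  have grow: "growth W n \<le> growth V (m * n)" for n
    by (rule growth_mono_filtration[OF fV(1) filtration_cover_mult[OF m(2)]])
  show "GKdim_wrt W \<le> ereal c'"
  proof (rule ereal_le_epsilon2)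
    fix e :: real assume e: "0 < e"
    define c where "c = c' + e"
    have "GKdim_wrt V < ereal c" using le e by (auto simp: c_def intro: le_less_trans)
    then have "eventually (\<lambda>n. ereal (log (real n) (real (growth V n))) < ereal c) sequentially"
      unfolding GKdim_wrt_def by (rule Limsup_lessD)
    then have ev: "eventually (\<lambda>n. log (real n) (real (growth V n)) < c) sequentially" by simp
    have lim: "filterlim (\<lambda>n. m * n) at_top sequentially"
      using m(1) by (intro filterlim_subseq) (simp add: strict_mono_def)
    have ev2: "eventually (\<lambda>n. log (real (m * n)) (real (growth V (m * n))) < c) sequentially"
      using lim ev by (auto simp: filterlim_iff)
    have "eventually (\<lambda>n. ereal (log (real n) (real (growth W n)))
             \<le> ereal (c * (1 + ln (real m) / ln (real n)))) sequentially"
      using ev2 eventually_ge_at_top[of 2]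
    proof eventually_elim
      case (elim n)
      have mn: "real m * real n > 1" using m(1) elim
      proof -
        have "1 * 2 \<le> m * n" using m(1) elim(2) by (intro mult_le_mono) auto
        then have "1 < m * n" by simp
        then have "real 1 < real (m * n)" by (simp only: of_nat_less_iff)
        then show ?thesis unfolding of_nat_mult of_nat_1 .
      qed
      have g: "0 < growth W n" using growth_pos[OF fW] .
      have "ln (real (growth W n)) \<le> ln (real (growth V (m * n)))"
        using grow[of n] g by simp
      also have "\<dots> \<le> c * ln (real m * real n)"
        using elim(1) mn by (simp add: log_def divide_simps)
      also have "ln (real m * real n) = ln (real m) + ln (real n)"
        using m(1) elim(2) by (simp add: ln_mult)
      finally have "ln (real (growth W n)) / ln (real n) \<le> (c * (ln (real m) + ln (real n))) / ln (real n)"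
        using elim(2) by (intro divide_right_mono) auto
      also have "\<dots> = c * (1 + ln (real m) / ln (real n))"
        using elim(2) by (simp add: field_simps)
      finally show ?case by (simp add: log_def)
    qed
    then have "GKdim_wrt W \<le> limsup (\<lambda>n. ereal (c * (1 + ln (real m) / ln (real n))))"
      unfolding GKdim_wrt_def by (rule Limsup_mono)
    also have "\<dots> = ereal c"
    proof (rule lim_imp_Limsup)
      have "filterlim (\<lambda>n. ln (real n)) at_top sequentially"
        by (rule filterlim_compose[OF ln_at_top filterlim_real_sequentially])
      then have "(\<lambda>n. ln (real m) / ln (real n)) \<longlonglongrightarrow> 0"
        by (intro real_tendsto_divide_at_top) auto
      then have "(\<lambda>n. c * (1 + ln (real m) / ln (real n))) \<longlonglongrightarrow> c * (1 + 0)"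
        by (intro tendsto_intros)
      then show "(\<lambda>n. ereal (c * (1 + ln (real m) / ln (real n)))) \<longlonglongrightarrow> ereal c" by simp
    qed simp
    finally show "GKdim_wrt W \<le> ereal c' + ereal e" by (simp add: c_def)
  qed
qed

lemma GKdim_eq: "generating_space V \<Longrightarrow> GKdim = GKdim_wrt V"
  unfolding GKdim_def by (rule antisym) (blast intro: GKdim_wrt_le someI)+

end

end

theory Submission
  imports Defs "HOL-Real_Asymp.Real_Asymp"
begin

text \<open>
  The algebra enters only through the size of the coefficients. If \<open>V\<close> is spanned by the
  generators of degree one, the homogeneous component \<open>R\<^sub>n\<close> is contained in
  \<open>V\<^sup>0 + \<dots> + V\<^sup>n\<close>, so \<open>dim R\<^sub>n\<close> is at most the growth function, and finite Gelfand-Kirillov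
  dimension bounds it by a power of \<open>n\<close> (lemma \<open>dim_component_polynomially_bounded\<close>). Hence the
  Hilbert series has integer coefficients and converges in the open unit disc.

  The rest is Fatou's theorem (\<open>integral_algebraic_series_rational\<close>): such a series \<open>f\<close>, if
  algebraic, is rational. Clear denominators in an algebraic equation to get
  \<open>q\<^sub>0 + q\<^sub>1 f + \<dots> + q\<^sub>d f\<^sup>d = 0\<close> with polynomials \<open>q\<^sub>i\<close> and \<open>q\<^sub>d \<noteq> 0\<close>. Multiplied by
  \<open>q\<^sub>d\<^bsup>d-1\<^esup>\<close> this becomes a monic equation of degree \<open>d\<close> for \<open>g = q\<^sub>d f\<close>, whose
  coefficients are polynomials and therefore bounded on the disc. A root of a monic polynomial is
  bounded in terms of the coefficients, so the function \<open>g\<close> is bounded on the disc, although \<open>f\<close>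
  itself need not be (\<open>algebraic_times_leading_coefficient_bounded\<close>). By Parseval's inequality the
  coefficients of \<open>g\<close> are square summable and so tend to zero; but they lie in a lattice
  \<open>(1/D)\<int>\<close>, so almost all of them vanish. Thus \<open>g\<close> is a polynomial and \<open>f = g / q\<^sub>d\<close> is
  rational.
\<close>

section \<open>Parseval's inequality for bounded power series\<close>

lemma roots_of_unity_orthogonality:
  assumes "i < m" "j < m"
  shows "(\<Sum>k<m. cis (2 * pi * real i / real m) ^ k * cnj (cis (2 * pi * real j / real m) ^ k)) =
    (if i = j then of_nat m else 0)"
proof -
  let ?w = "\<lambda>i. cis (2 * pi * real i / real m)"
  let ?x = "?w i * cnj (?w j)"
  have m: "m > 0" using assms by simp
  have unit: "cnj (?w j) * ?w j = 1"
    using complex_norm_square[of "?w j"] by (simp add: mult.commute)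
  have pow: "?w i ^ m = 1" for i
  proof -
    have "?w i ^ m = cis (real m * (2 * pi * real i / real m))" by (rule Complex.DeMoivre)
    also have "real m * (2 * pi * real i / real m) = 2 * pi * real i" using m by simp
    finally show ?thesis by simp
  qed
  have sum: "(\<Sum>k<m. ?w i ^ k * cnj (?w j ^ k)) = (\<Sum>k<m. ?x ^ k)"
    by (simp add: power_mult_distrib)
  show ?thesis
  proof (cases "i = j")
    case True
    have "?x = 1" unfolding True using unit by (simp only: mult.commute)
    then show ?thesis unfolding sum using True by simp
  next
    case False
    have "?x \<noteq> 1"
    proof
      assume "?x = 1"
      then have "?w i * (cnj (?w j) * ?w j) = ?w j" by (simp only: mult.assoc[symmetric] mult_1_left)
      then have "?w i = ?w j" unfolding unit by simp
      moreover have "inj_on ?w {..<m}"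
        using Complex.bij_betw_roots_unity[OF m] by (simp add: bij_betw_def)
      ultimately show False using False assms by (auto dest: inj_onD)
    qed
    moreover have "?x ^ m = 1" using pow[of i] pow[of j] by (simp add: power_mult_distrib flip: complex_cnj_power)
    ultimately show ?thesis unfolding sum using False by (simp add: geometric_sum)
  qed
qed

text \<open>Averaging over the \<open>m\<close>-th roots of unity, in place of integrating over a circle, keeps
  everything in finite sums; it is exact for polynomials of degree below \<open>m\<close>.\<close>

lemma discrete_Parseval:
  fixes a :: "nat \<Rightarrow> complex"
  shows "(\<Sum>k<m. (norm (\<Sum>n<m. a n * cis (2 * pi * real n / real m) ^ k))\<^sup>2) =
    real m * (\<Sum>n<m. (norm (a n))\<^sup>2)"
proof -
  let ?w = "\<lambda>i. cis (2 * pi * real i / real m)"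
  have "complex_of_real (\<Sum>k<m. (norm (\<Sum>n<m. a n * ?w n ^ k))\<^sup>2) =
    (\<Sum>k<m. \<Sum>i<m. \<Sum>j<m. a i * cnj (a j) * (?w i ^ k * cnj (?w j ^ k)))"
    unfolding of_real_sum complex_norm_square
    by (intro sum.cong refl) (simp add: sum_product mult_ac)
  also have "\<dots> = (\<Sum>i<m. \<Sum>j<m. \<Sum>k<m. a i * cnj (a j) * (?w i ^ k * cnj (?w j ^ k)))"
    by (rule trans[OF sum.swap]) (rule sum.cong[OF refl sum.swap])
  also have "\<dots> = (\<Sum>i<m. \<Sum>j<m. a i * cnj (a j) * (if i = j then of_nat m else 0))"
    by (intro sum.cong refl, subst sum_distrib_left[symmetric], subst roots_of_unity_orthogonality) auto
  also have "\<dots> = (\<Sum>i<m. a i * cnj (a i) * of_nat m)"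
    by (intro sum.cong refl) (simp add: if_distrib cong: if_cong)
  also have "\<dots> = complex_of_real (real m * (\<Sum>n<m. (norm (a n))\<^sup>2))"
    unfolding of_real_mult of_real_sum complex_norm_square
    by (simp add: sum_distrib_left mult_ac)
  finally show ?thesis unfolding of_real_eq_iff .
qed

text \<open>
  On the circle of radius \<open>r < 1\<close> the partial sums of \<open>g\<close> converge uniformly, so a long enough
  one is bounded by \<open>M + e\<close> there, and the discrete identity applies to it. The passage to the
  limits \<open>e \<rightarrow> 0\<close> and \<open>r \<rightarrow> 1\<close> is harmless because the number \<open>N\<close> of terms is fixed.
\<close>

lemma Parseval_inequality:
  fixes g :: "complex fps"
  assumes radius: "fps_conv_radius g \<ge> 1"
    and bound: "\<And>z. norm z < 1 \<Longrightarrow> norm (eval_fps g z) \<le> M"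
  shows "(\<Sum>n<N. (norm (fps_nth g n))\<^sup>2) \<le> M\<^sup>2"
proof -
  have M: "M \<ge> 0" by (rule order_trans[OF norm_ge_zero bound[of 0]]) simp
  have inner: "(\<Sum>n<N. (norm (fps_nth g n * of_real r ^ n))\<^sup>2) \<le> (M + e)\<^sup>2"
    if r: "0 < r" "r < 1" and e: "e > 0" for r e :: real
  proof -
    have conv: "ereal (norm z) < fps_conv_radius g" if "norm z = r" for z
      using less_le_trans[OF _ radius, of "ereal (norm z)"] that r by simp
    have "summable (\<lambda>n. norm (fps_nth g n * of_real r ^ n))"
      using norm_summable_fps[OF conv[of "of_real r"]] r by simp
    from suminf_exist_split[OF e this] obtain m0 where
      m0: "\<And>n. n \<ge> m0 \<Longrightarrow> norm (\<Sum>i. norm (fps_nth g (i + n) * of_real r ^ (i + n))) < e"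
      by blast
    \<comment> \<open>\<open>Suc N\<close> rather than \<open>N\<close>, so that there is at least one root of unity to average over\<close>
    define m where "m = max (Suc N) m0"
    \<comment> \<open>the tail is estimated at the point \<open>r\<close>, which makes the choice of \<open>m\<close> uniform on the circle\<close>
    have trunc: "norm (\<Sum>n<m. fps_nth g n * z ^ n) \<le> M + e" if z: "norm z = r" for z
    proof -
      have sm: "summable (\<lambda>n. norm (fps_nth g n * z ^ n))" by (rule norm_summable_fps[OF conv[OF z]])
      have "eval_fps g z = (\<Sum>n. fps_nth g (n + m) * z ^ (n + m)) + (\<Sum>n<m. fps_nth g n * z ^ n)"
        unfolding eval_fps_def by (rule suminf_split_initial_segment[OF summable_norm_cancel[OF sm]])
      moreover have "norm (\<Sum>n. fps_nth g (n + m) * z ^ (n + m)) \<le> e"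
      proof -
        have "norm (\<Sum>n. fps_nth g (n + m) * z ^ (n + m))
            \<le> (\<Sum>n. norm (fps_nth g (n + m) * z ^ (n + m)))"
          by (rule summable_norm) (rule summable_ignore_initial_segment[OF sm])
        also have "\<dots> = (\<Sum>n. norm (fps_nth g (n + m) * of_real r ^ (n + m)))"
          using z r by (simp add: norm_mult norm_power)
        also have "\<dots> \<le> e" using m0[of m] by (simp add: m_def)
        finally show ?thesis .
      qed
      moreover have "norm (eval_fps g z) \<le> M" using bound z r by simp
      ultimately show ?thesis
        using norm_triangle_ineq4[of "eval_fps g z" "\<Sum>n. fps_nth g (n + m) * z ^ (n + m)"] by simp
    qed
    let ?w = "\<lambda>i. cis (2 * pi * real i / real m)"
    have "real m * (\<Sum>n<m. (norm (fps_nth g n * of_real r ^ n))\<^sup>2) =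
      (\<Sum>k<m. (norm (\<Sum>n<m. (fps_nth g n * of_real r ^ n) * ?w n ^ k))\<^sup>2)"
      by (rule discrete_Parseval[symmetric])
    also have "\<dots> = (\<Sum>k<m. (norm (\<Sum>n<m. fps_nth g n * (of_real r * ?w k) ^ n))\<^sup>2)"
    proof -
      have "?w n ^ k = ?w k ^ n" for n k by (simp add: Complex.DeMoivre mult.commute mult.left_commute)
      then have "(fps_nth g n * of_real r ^ n) * ?w n ^ k = fps_nth g n * (of_real r * ?w k) ^ n" for n k
        by (simp only: power_mult_distrib mult.assoc)
      then show ?thesis by (simp only:)
    qed
    also have "\<dots> \<le> (\<Sum>k<m. (M + e)\<^sup>2)"
      by (intro sum_mono power_mono trunc norm_ge_zero) (use r in \<open>simp add: norm_mult\<close>)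
    also have "\<dots> = real m * (M + e)\<^sup>2" by simp
    finally have "(\<Sum>n<m. (norm (fps_nth g n * of_real r ^ n))\<^sup>2) \<le> (M + e)\<^sup>2"
      by (rule mult_left_le_imp_le) (simp add: m_def)
    moreover have "(\<Sum>n<N. (norm (fps_nth g n * of_real r ^ n))\<^sup>2) \<le>
      (\<Sum>n<m. (norm (fps_nth g n * of_real r ^ n))\<^sup>2)"
      by (rule sum_mono2) (auto simp: m_def)
    ultimately show ?thesis by linarith
  qed
  have inner': "(\<Sum>n<N. (norm (fps_nth g n * of_real r ^ n))\<^sup>2) \<le> M\<^sup>2" if r: "0 < r" "r < 1" for r :: real
  proof (rule tendsto_lowerbound)
    have "((\<lambda>e. (M + e)\<^sup>2) \<longlongrightarrow> (M + 0)\<^sup>2) (at_right 0)" by (intro tendsto_intros)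
    then show "((\<lambda>e. (M + e)\<^sup>2) \<longlongrightarrow> M\<^sup>2) (at_right 0)" by simp
    show "\<forall>\<^sub>F e in at_right 0. (\<Sum>n<N. (norm (fps_nth g n * of_real r ^ n))\<^sup>2) \<le> (M + e)\<^sup>2"
      using eventually_at_right_less[of 0] by eventually_elim (rule inner[OF r])
  qed simp
  show ?thesis
  proof (rule tendsto_upperbound)
    have "((\<lambda>r::real. \<Sum>n<N. (norm (fps_nth g n * of_real r ^ n))\<^sup>2) \<longlongrightarrow>
      (\<Sum>n<N. (norm (fps_nth g n * of_real 1 ^ n))\<^sup>2)) (at_left 1)" by (intro tendsto_intros)
    then show "((\<lambda>r::real. \<Sum>n<N. (norm (fps_nth g n * of_real r ^ n))\<^sup>2) \<longlongrightarrow>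
      (\<Sum>n<N. (norm (fps_nth g n))\<^sup>2)) (at_left 1)" by simp
    have "\<forall>\<^sub>F r in at_left (1::real). r \<in> {0<..<1}" by (rule eventually_at_left_real) simp
    then show "\<forall>\<^sub>F r in at_left (1::real). (\<Sum>n<N. (norm (fps_nth g n * of_real r ^ n))\<^sup>2) \<le> M\<^sup>2"
      by eventually_elim (use inner' in simp)
  qed simp
qed

section \<open>Algebraic power series on the unit disc\<close>

lemma norm_poly_bounded_unit_disc:
  fixes p :: "complex poly"
  obtains B where "\<And>z. norm z < 1 \<Longrightarrow> norm (poly p z) \<le> B"
proof -
  have "bounded (poly p ` cball 0 1)"
    by (intro compact_imp_bounded compact_continuous_image continuous_intros) auto
  then obtain B where "\<forall>z\<in>cball 0 1. norm (poly p z) \<le> B" unfolding bounded_iff by blast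
  then show thesis by (intro that[of B]) auto
qed

lemma eval_fps_sum:
  fixes f :: "'i \<Rightarrow> complex fps"
  assumes "\<And>i. i \<in> A \<Longrightarrow> ereal (norm z) < fps_conv_radius (f i)"
  shows "eval_fps (\<Sum>i\<in>A. f i) z = (\<Sum>i\<in>A. eval_fps (f i) z)"
proof -
  have "eval_fps (\<Sum>i\<in>A. f i) z = (\<Sum>n. \<Sum>i\<in>A. fps_nth (f i) n * z ^ n)"
    by (simp add: eval_fps_def fps_sum_nth sum_distrib_right)
  also have "\<dots> = (\<Sum>i\<in>A. eval_fps (f i) z)"
    unfolding eval_fps_def by (rule suminf_sum) (rule summable_fps[OF assms])
  finally show ?thesis .
qed

lemma root_of_monic_polynomial_bounded:
  fixes v :: complex
  assumes d: "0 < d" and root: "v ^ d + (\<Sum>i<d. c i * v ^ i) = 0" and c: "\<And>i. i < d \<Longrightarrow> norm (c i) \<le> B i"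
  shows "norm v \<le> 1 + (\<Sum>i<d. B i)"
proof (cases "norm v \<le> 1")
  case True
  moreover have "0 \<le> (\<Sum>i<d. B i)" by (rule sum_nonneg) (use c norm_ge_zero order_trans in blast)
  ultimately show ?thesis by simp
next
  case False
  obtain k where k: "d = Suc k" using d gr0_conv_Suc by auto
  have "norm v ^ d = norm (\<Sum>i<d. c i * v ^ i)"
    using root by (metis add_eq_0_iff norm_minus_cancel norm_power)
  also have "\<dots> \<le> (\<Sum>i<d. norm (c i) * norm v ^ i)"
    by (rule order_trans[OF norm_sum]) (simp add: norm_mult norm_power)
  also have "\<dots> \<le> (\<Sum>i<d. B i * norm v ^ k)"
    using False by (intro sum_mono mult_mono c power_increasing order_trans[OF norm_ge_zero c]) (auto simp: k)
  also have "\<dots> = (\<Sum>i<d. B i) * norm v ^ k" by (simp add: sum_distrib_right)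
  finally have "norm v * norm v ^ k \<le> (\<Sum>i<d. B i) * norm v ^ k" by (simp add: k)
  moreover have "0 < norm v ^ k" using False by (intro zero_less_power) linarith
  ultimately have "norm v \<le> (\<Sum>i<d. B i)" by (rule mult_right_le_imp_le)
  then show ?thesis by simp
qed

text \<open>
  Multiplication by the leading coefficient \<open>q d\<close> turns \<open>f\<close> into a root of a monic polynomial
  over the ring of polynomials: its coefficient of degree \<open>i\<close> is \<open>q i * q d ^ (d - 1 - i)\<close>.
  Since the monic equation is obtained by multiplication alone, it also holds at the zeros of
  \<open>q d\<close>, where \<open>f\<close> cannot be controlled directly.
\<close>

lemma algebraic_times_leading_coefficient_bounded:
  fixes f :: "complex fps" and q :: "nat \<Rightarrow> complex poly"
  assumes radius: "fps_conv_radius f \<ge> 1" and d: "0 < d"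
    and rel: "(\<Sum>i\<le>d. fps_of_poly (q i) * f ^ i) = 0"
  obtains M where "\<And>z. norm z < 1 \<Longrightarrow> norm (eval_fps (fps_of_poly (q d) * f) z) \<le> M"
proof -
  define c where "c i = q i * q d ^ (d - 1 - i)" for i
  have "\<exists>B. \<forall>z. norm z < 1 \<longrightarrow> norm (poly (c i) z) \<le> B" for i
    using norm_poly_bounded_unit_disc[of "c i"] by metis
  then obtain B where B: "\<And>i z. norm z < 1 \<Longrightarrow> norm (poly (c i) z) \<le> B i" by metis
  have "norm (eval_fps (fps_of_poly (q d) * f) z) \<le> 1 + (\<Sum>i<d. B i)" if z: "norm z < 1" for z
  proof (rule root_of_monic_polynomial_bounded[OF d])
    let ?w = "eval_fps f z" and ?a = "poly (q d) z"
    have conv: "ereal (norm z) < fps_conv_radius f"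
      using z radius by (metis ereal_less(3) less_le_trans)
    have convp: "ereal (norm z) < fps_conv_radius (f ^ i)" for i
      using conv fps_conv_radius_power[of f i] by (rule less_le_trans)
    have convm: "ereal (norm z) < fps_conv_radius (fps_of_poly (q i) * f ^ i)" for i
      using fps_conv_radius_mult[of "fps_of_poly (q i)" "f ^ i"] convp[of i] by (auto intro: less_le_trans)
    have v: "eval_fps (fps_of_poly (q d) * f) z = ?a * ?w"
      using conv by (simp add: eval_fps_mult)
    have "(\<Sum>i\<le>d. poly (q i) z * ?w ^ i) = eval_fps (\<Sum>i\<le>d. fps_of_poly (q i) * f ^ i) z"
      by (subst eval_fps_sum[OF convm]) (simp add: eval_fps_mult eval_fps_power conv convp)
    also have "\<dots> = 0" by (simp add: rel)
    finally have "?a ^ (d - 1) * (\<Sum>i\<le>d. poly (q i) z * ?w ^ i) = 0" by simp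
    also have "{..d} = insert d {..<d}" by auto
    also have "?a ^ (d - 1) * (\<Sum>i\<in>insert d {..<d}. poly (q i) z * ?w ^ i) =
      ?a ^ (d - 1) * (?a * ?w ^ d) + (\<Sum>i<d. ?a ^ (d - 1) * (poly (q i) z * ?w ^ i))"
      by (simp add: distrib_left sum_distrib_left)
    also have "?a ^ (d - 1) * (?a * ?w ^ d) = (?a * ?w) ^ d"
      using d by (cases d) (simp_all add: power_mult_distrib mult_ac)
    also have "(\<Sum>i<d. ?a ^ (d - 1) * (poly (q i) z * ?w ^ i)) = (\<Sum>i<d. poly (c i) z * (?a * ?w) ^ i)"
    proof (rule sum.cong[OF refl])
      fix i assume "i \<in> {..<d}"
      then have "?a ^ (d - 1) = ?a ^ (d - 1 - i) * ?a ^ i" by (simp flip: power_add)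
      then show "?a ^ (d - 1) * (poly (q i) z * ?w ^ i) = poly (c i) z * (?a * ?w) ^ i"
        by (simp add: c_def power_mult_distrib mult_ac)
    qed
    finally show "eval_fps (fps_of_poly (q d) * f) z ^ d +
      (\<Sum>i<d. poly (c i) z * eval_fps (fps_of_poly (q d) * f) z ^ i) = 0" unfolding v .
  qed (rule B[OF z])
  then show thesis by (rule that)
qed

text \<open>A nonzero element of the lattice \<open>(1/D)\<int>\<close> has absolute value at least \<open>1/\<bar>D\<bar>\<close>, which square
  summable coefficients can reach only finitely often.\<close>

lemma bounded_fps_with_integer_multiple_is_polynomial:
  fixes g :: "complex fps" and D :: int
  assumes radius: "fps_conv_radius g \<ge> 1"
    and bound: "\<And>z. norm z < 1 \<Longrightarrow> norm (eval_fps g z) \<le> M"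
    and D: "D \<noteq> 0" and int: "\<And>n. of_int D * fps_nth g n \<in> \<int>"
  shows "\<exists>n0. \<forall>n\<ge>n0. fps_nth g n = 0"
proof -
  have "summable (\<lambda>n. (norm (fps_nth g n))\<^sup>2)"
    by (rule summableI_nonneg_bounded[OF _ Parseval_inequality[OF radius bound]]) auto
  then have "(\<lambda>n. (norm (fps_nth g n))\<^sup>2) \<longlonglongrightarrow> 0" by (rule summable_LIMSEQ_zero)
  then have "\<forall>\<^sub>F n in sequentially. (norm (fps_nth g n))\<^sup>2 < (1 / of_int \<bar>D\<bar>)\<^sup>2"
    by (rule order_tendstoD(2)) (use D in simp)
  then have "\<forall>\<^sub>F n in sequentially. fps_nth g n = 0"
  proof eventually_elim
    case (elim n)
    have "norm (fps_nth g n) < 1 / of_int \<bar>D\<bar>"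
      using elim by (rule power_less_imp_less_base) simp
    then have "norm (of_int D * fps_nth g n) < 1"
      using D by (simp add: norm_mult field_simps)
    moreover obtain k where k: "of_int D * fps_nth g n = of_int k" using int[of n] by (auto elim: Ints_cases)
    ultimately have "\<bar>k\<bar> < 1" by simp
    then show ?case using k D by simp
  qed
  then show ?thesis by (simp add: eventually_sequentially)
qed

section \<open>Clearing denominators\<close>

text \<open>Used twice: with the polynomials inside the Laurent series to make an algebraic equation
  polynomial, and with the integers inside the rationals to make a polynomial integral.\<close>

lemma common_denominator:
  fixes S :: "'f::field set"
  assumes one: "1 \<in> S" and mult: "\<And>x y. x \<in> S \<Longrightarrow> y \<in> S \<Longrightarrow> x * y \<in> S"
    and frac: "\<And>i. i \<in> I \<Longrightarrow> \<exists>a\<in>S. \<exists>b\<in>S. b \<noteq> 0 \<and> c i = a / b" and fin: "finite I"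
  shows "\<exists>D\<in>S. D \<noteq> 0 \<and> (\<forall>i\<in>I. D * c i \<in> S)"
  using fin frac
proof (induction I rule: finite_induct)
  case empty
  then show ?case using one by (intro bexI[of _ 1]) auto
next
  case (insert j I)
  obtain D where D: "D \<in> S" "D \<noteq> 0" "\<And>i. i \<in> I \<Longrightarrow> D * c i \<in> S" using insert by auto
  obtain a b where ab: "a \<in> S" "b \<in> S" "b \<noteq> 0" "c j = a / b" using insert.prems[of j] by auto
  have "b * D * c j = D * a" using ab by simp
  moreover have "b * D * c i \<in> S" if "i \<in> I" for i
    using mult[OF ab(2) D(3)[OF that]] by (simp only: mult.assoc)
  ultimately have "\<forall>i\<in>insert j I. b * D * c i \<in> S" using D ab mult by auto
  then show ?case using D ab mult by (intro bexI[of _ "b * D"]) auto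
qed

lemma algebraic_series_polynomial_relation:
  assumes "algebraic_series f"
  obtains d and q :: "nat \<Rightarrow> rat poly"
  where "q d \<noteq> 0" "(\<Sum>i\<le>d. fps_of_poly (q i) * f ^ i) = 0"
proof -
  let ?h = "\<lambda>p :: rat poly. fps_to_fls (fps_of_poly p)"
  obtain P where P: "\<And>i. coeff P i \<in> rational_functions" "P \<noteq> 0" "poly P (fps_to_fls f) = 0"
    using assms unfolding algebraic_series_def by blast
  have "\<exists>D\<in>range ?h. D \<noteq> 0 \<and> (\<forall>i\<in>{..degree P}. D * coeff P i \<in> range ?h)"
  proof (rule common_denominator)
    show "1 \<in> range ?h" by (rule range_eqI[of _ _ 1]) simp
    fix x y assume "x \<in> range ?h" "y \<in> range ?h"
    then show "x * y \<in> range ?h" by (auto simp flip: fls_times_fps_to_fls fps_of_poly_mult)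
  next
    fix i
    from P(1)[of i] obtain p q :: "rat poly" where "coeff P i = ?h p / ?h q" "q \<noteq> 0"
      unfolding rational_functions_def by blast
    moreover from this have "?h q \<noteq> 0" using fps_of_poly_eq_iff[of q 0] by simp
    ultimately show "\<exists>a\<in>range ?h. \<exists>b\<in>range ?h. b \<noteq> 0 \<and> coeff P i = a / b" by blast
  qed simp
  then obtain D where D: "D \<noteq> 0" "\<forall>i\<in>{..degree P}. \<exists>q. D * coeff P i = ?h q" by blast
  then obtain q where q: "\<And>i. i \<le> degree P \<Longrightarrow> D * coeff P i = ?h (q i)"
    by (metis atMost_iff)
  have "?h (q (degree P)) \<noteq> 0" using q[of "degree P"] D(1) P(2) by (metis le_refl leading_coeff_0_iff mult_eq_0_iff)
  then have "q (degree P) \<noteq> 0" by auto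
  moreover have "fps_to_fls (\<Sum>i\<le>degree P. fps_of_poly (q i) * f ^ i) = D * poly P (fps_to_fls f)"
  proof -
    have sum: "fps_to_fls (\<Sum>i\<in>A. g i) = (\<Sum>i\<in>A. fps_to_fls (g i))" for A and g :: "nat \<Rightarrow> rat fps"
      by (induction A rule: infinite_finite_induct) auto
    have "D * poly P (fps_to_fls f) = (\<Sum>i\<le>degree P. (D * coeff P i) * fps_to_fls f ^ i)"
      by (simp add: poly_altdef sum_distrib_left mult.assoc)
    also have "\<dots> = (\<Sum>i\<le>degree P. ?h (q i) * fps_to_fls f ^ i)"
      by (intro sum.cong refl) (simp add: q)
    finally show ?thesis by (simp add: sum fls_times_fps_to_fls fps_to_fls_power)
  qed
  then have "(\<Sum>i\<le>degree P. fps_of_poly (q i) * f ^ i) = 0" using P(3) by simp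
  ultimately show thesis by (rule that)
qed

lemma integer_multiple_of_rat_poly:
  fixes p :: "rat poly"
  shows "\<exists>D::int. D \<noteq> 0 \<and> (\<forall>n. of_int D * coeff p n \<in> \<int>)"
proof -
  have "\<exists>D\<in>(\<int> :: rat set). D \<noteq> 0 \<and> (\<forall>i\<in>{..degree p}. D * coeff p i \<in> \<int>)"
  proof (rule common_denominator)
    fix i
    obtain a b :: int where "b > 0" "coeff p i = of_int a / of_int b"
      by (metis quotient_of_denom_pos' quotient_of_div prod.collapse)
    then show "\<exists>a\<in>(\<int> :: rat set). \<exists>b\<in>\<int>. b \<noteq> 0 \<and> coeff p i = a / b"
      by (intro bexI[of _ "of_int a"] bexI[of _ "of_int b"]) auto
  qed auto
  then obtain D :: int where D: "D \<noteq> 0" "\<And>i. i \<le> degree p \<Longrightarrow> of_int D * coeff p i \<in> \<int>"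
    by (auto elim!: Ints_cases)
  then have "of_int D * coeff p n \<in> \<int>" for n
    by (cases "n \<le> degree p") (simp_all add: coeff_eq_0)
  then show ?thesis using D(1) by blast
qed

section \<open>Fatou's theorem\<close>

definition complex_fps :: "rat fps \<Rightarrow> complex fps" where
  "complex_fps f = Abs_fps (\<lambda>n. of_rat (fps_nth f n))"

lemma complex_fps_nth [simp]: "fps_nth (complex_fps f) n = of_rat (fps_nth f n)"
  by (simp add: complex_fps_def)

lemma complex_fps_mult: "complex_fps (f * g) = complex_fps f * complex_fps g"
  by (rule fps_ext) (simp add: fps_mult_nth of_rat_sum of_rat_mult)

lemma complex_fps_power: "complex_fps (f ^ n) = complex_fps f ^ n"
proof (induction n)
  case 0
  show ?case by (rule fps_ext) simp
qed (simp add: complex_fps_mult)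

lemma complex_fps_sum: "complex_fps (\<Sum>i\<in>A. f i) = (\<Sum>i\<in>A. complex_fps (f i))"
  by (rule fps_ext) (simp add: fps_sum_nth of_rat_sum)

lemma complex_fps_of_poly: "complex_fps (fps_of_poly p) = fps_of_poly (map_poly of_rat p)"
  by (rule fps_ext) (simp add: coeff_map_poly)

text \<open>Only the leading coefficient \<open>q d\<close> has to be made integral, since only the arithmetic of
  \<open>q d * f\<close> matters; on the other \<open>q i\<close> a bound on the disc suffices.\<close>

theorem integral_algebraic_series_rational:
  fixes f :: "rat fps"
  assumes int: "\<And>n. fps_nth f n \<in> \<int>" and radius: "fps_conv_radius (complex_fps f) \<ge> 1"
    and alg: "algebraic_series f"
  shows "rational_series f"
proof -
  obtain d and q :: "nat \<Rightarrow> rat poly"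
    where q: "q d \<noteq> 0" and rel: "(\<Sum>i\<le>d. fps_of_poly (q i) * f ^ i) = 0"
    using algebraic_series_polynomial_relation[OF alg] .
  have d: "0 < d"
  proof (rule ccontr)
    assume "\<not> 0 < d"
    then have "fps_of_poly (q d) = 0" using rel by simp
    then show False using q fps_of_poly_eq_iff[of "q d" 0] by simp
  qed
  let ?g = "fps_of_poly (q d) * f"
  have g: "complex_fps ?g = fps_of_poly (map_poly of_rat (q d)) * complex_fps f"
    by (simp add: complex_fps_mult complex_fps_of_poly)
  have "(\<Sum>i\<le>d. fps_of_poly (map_poly of_rat (q i)) * complex_fps f ^ i) = complex_fps 0"
    unfolding rel[symmetric] by (simp add: complex_fps_sum complex_fps_mult complex_fps_power complex_fps_of_poly)
  also have "complex_fps 0 = 0" by (rule fps_ext) simp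
  finally have "\<exists>M. \<forall>z. norm z < 1 \<longrightarrow> norm (eval_fps (complex_fps ?g) z) \<le> M"
    unfolding g by (rule algebraic_times_leading_coefficient_bounded[OF radius d]) blast
  then obtain M where M: "\<And>z. norm z < 1 \<Longrightarrow> norm (eval_fps (complex_fps ?g) z) \<le> M" by blast
  have radius_g: "fps_conv_radius (complex_fps ?g) \<ge> 1"
    unfolding g by (rule order_trans[OF _ fps_conv_radius_mult]) (use radius in simp)
  obtain D :: int where D: "D \<noteq> 0" "\<And>n. of_int D * coeff (q d) n \<in> \<int>"
    using integer_multiple_of_rat_poly[of "q d"] by blast
  have "of_int D * fps_nth (complex_fps ?g) n \<in> \<int>" for n
  proof -
    have "of_int D * fps_nth ?g n = (\<Sum>i=0..n. (of_int D * coeff (q d) i) * fps_nth f (n - i))"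
      by (simp add: fps_mult_nth sum_distrib_left mult.assoc)
    also have "\<dots> \<in> \<int>" by (intro Ints_sum Ints_mult D int)
    finally obtain k where "of_int D * fps_nth ?g n = of_int k" by (auto elim: Ints_cases)
    then have "of_rat (of_int D * fps_nth ?g n) = (of_rat (of_int k) :: complex)" by simp
    then show ?thesis by (simp add: of_rat_mult)
  qed
  from bounded_fps_with_integer_multiple_is_polynomial[OF radius_g M D(1) this]
  obtain n0 where n0: "\<And>n. n \<ge> n0 \<Longrightarrow> fps_nth ?g n = 0" by auto
  have "fps_of_poly (truncate_fps n0 ?g) = ?g"
    unfolding fps_of_poly_truncate by (rule fps_ext) (simp add: n0)
  then have "fps_to_fls (fps_of_poly (q d)) * fps_to_fls f = fps_to_fls (fps_of_poly (truncate_fps n0 ?g))"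
    by (simp add: fls_times_fps_to_fls)
  moreover have "fps_to_fls (fps_of_poly (q d)) \<noteq> 0" using q fps_of_poly_eq_iff[of "q d" 0] by simp
  ultimately have "fps_to_fls f = fps_to_fls (fps_of_poly (truncate_fps n0 ?g)) / fps_to_fls (fps_of_poly (q d))"
    by (simp add: field_simps)
  then show ?thesis using q unfolding rational_series_def rational_functions_def by blast
qed

section \<open>Growth of the homogeneous components\<close>

context graded_algebra
begin

text \<open>Uniqueness of the decomposition, applied to the given one and to the decomposition of the
  homogeneous element \<open>x\<close> as itself in degree \<open>n\<close>.\<close>

lemma homogeneous_component_unique:
  assumes fin: "finite I" and g: "\<And>i. i \<in> I \<Longrightarrow> g i \<in> R i"
    and x: "x \<in> R n" "x = (\<Sum>i\<in>I. g i)"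
  shows "x = (if n \<in> I then g n else 0)"
proof -
  define f1 where "f1 i = (if i \<in> I then g i else 0)" for i
  define f2 where "f2 i = (if i = n then x else 0)" for i
  have zero: "0 \<in> R i" for i using subspace_component subspace_0 by blast
  have supp1: "{i. f1 i \<noteq> 0} \<subseteq> I" by (auto simp: f1_def)
  have supp2: "{i. f2 i \<noteq> 0} \<subseteq> {n}" by (auto simp: f2_def)
  have "(\<Sum>i | f1 i \<noteq> 0. f1 i) = (\<Sum>i\<in>I. f1 i)"
    using fin supp1 by (intro sum.mono_neutral_left) auto
  also have "\<dots> = x" unfolding x(2) by (simp add: f1_def)
  finally have sum1: "(\<Sum>i | f1 i \<noteq> 0. f1 i) = x" .
  have 1: "(\<forall>i. f1 i \<in> R i) \<and> finite {i. f1 i \<noteq> 0} \<and> x = (\<Sum>i | f1 i \<noteq> 0. f1 i)"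
  proof (intro conjI allI)
    show "f1 i \<in> R i" for i using g zero by (cases "i \<in> I") (simp_all add: f1_def)
    show "finite {i. f1 i \<noteq> 0}" using supp1 fin by (rule finite_subset)
    show "x = (\<Sum>i | f1 i \<noteq> 0. f1 i)" by (rule sum1[symmetric])
  qed
  have "(\<Sum>i | f2 i \<noteq> 0. f2 i) = (\<Sum>i\<in>{n}. f2 i)"
    using supp2 by (intro sum.mono_neutral_left) auto
  also have "\<dots> = x" by (simp add: f2_def)
  finally have sum2: "(\<Sum>i | f2 i \<noteq> 0. f2 i) = x" .
  have 2: "(\<forall>i. f2 i \<in> R i) \<and> finite {i. f2 i \<noteq> 0} \<and> x = (\<Sum>i | f2 i \<noteq> 0. f2 i)"
  proof (intro conjI allI)
    show "f2 i \<in> R i" for i using x(1) zero by (cases "i = n") (simp_all add: f2_def)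
    show "finite {i. f2 i \<noteq> 0}" using supp2 by (rule finite_subset) simp
    show "x = (\<Sum>i | f2 i \<noteq> 0. f2 i)" by (rule sum2[symmetric])
  qed
  obtain f where f: "\<forall>f'. (\<forall>i. f' i \<in> R i) \<and> finite {i. f' i \<noteq> 0} \<and>
      x = (\<Sum>i | f' i \<noteq> 0. f' i) \<longrightarrow> f' = f"
    using direct_sum[of x] by (rule ex1E)
  have "f1 = f2"
    using f[THEN spec, THEN mp, OF 1] f[THEN spec, THEN mp, OF 2] by (rule trans[OF _ sym])
  then have "f1 n = f2 n" by simp
  then show ?thesis by (simp add: f1_def f2_def)
qed

text \<open>
  If \<open>R 0 = {0}\<close>, a unit \<open>e\<close> could only have components of positive degree. Multiplication by it
  would then raise degrees, and comparing components of degree \<open>n\<close> in \<open>x = e * x\<close> gives \<open>x = 0\<close>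
  for every homogeneous \<open>x\<close>, so that \<open>e\<close> itself is zero.
\<close>

lemma unity_homogeneous: "unity \<subseteq> R 0"
proof
  fix e assume e: "e \<in> unity"
  show "e \<in> R 0"
  proof (cases "R 0 = {0}")
    case False
    then obtain e' where "e' \<in> unity" "R 0 = span {e'}" using component_0 by blast
    moreover from this have "e' = e" using unity_unique[OF e] by blast
    ultimately show ?thesis using span_base[of e "{e}"] by simp
  next
    case True
    obtain g where "(\<forall>i. g i \<in> R i) \<and> finite {i. g i \<noteq> 0} \<and> e = (\<Sum>i | g i \<noteq> 0. g i)"
      using ex1_implies_ex[OF direct_sum[of e]] by (rule exE)
    then obtain I where g: "finite I" "\<And>i. g i \<in> R i" "e = (\<Sum>i\<in>I. g i)" by (elim conjE) simp
    have "x = 0" if x: "x \<in> R n" for x n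
    proof -
      have "x = e * x" using unity_mult(1)[OF e] by simp
      also have "\<dots> = (\<Sum>i\<in>I. g i * x)" by (simp add: g(3) sum_distrib_right)
      also have "\<dots> = (\<Sum>k\<in>(\<lambda>i. i + n) ` I. g (k - n) * x)"
        by (subst sum.reindex) (auto simp: inj_on_def)
      finally have sum: "x = (\<Sum>k\<in>(\<lambda>i. i + n) ` I. g (k - n) * x)" .
      have "x = (if n \<in> (\<lambda>i. i + n) ` I then g (n - n) * x else 0)"
      proof (rule homogeneous_component_unique[OF _ _ x sum])
        show "finite ((\<lambda>i. i + n) ` I)" using g(1) by simp
        show "g (k - n) * x \<in> R k" if "k \<in> (\<lambda>i. i + n) ` I" for k
          using mult_component[OF g(2) x] that by auto
      qed
      moreover have "g 0 = 0" using g(2)[of 0] True by simp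
      ultimately show ?thesis by (simp split: if_splits)
    qed
    then have "e = 0" unfolding g(3) using g(2) by (intro sum.neutral) blast
    then show ?thesis using True by simp
  qed
qed

lemma space_power_homogeneous:
  assumes "V \<subseteq> R 1" shows "space_power V n \<subseteq> R n"
proof (induction n rule: less_induct)
  case (less n)
  consider "n = 0" | "n = 1" | k where "n = Suc (Suc k)"
    by (metis One_nat_def not0_implies_Suc)
  then show ?case
  proof cases
    case 1
    then show ?thesis using span_minimal[OF unity_homogeneous subspace_component] by simp
  next
    case 2
    then show ?thesis using span_minimal[OF assms subspace_component] by simp
  next
    case 3
    have "{x * y | x y. x \<in> space_power V (Suc k) \<and> y \<in> V} \<subseteq> R n"
    proof clarify
      fix x y assume "x \<in> space_power V (Suc k)" "y \<in> V"
      then show "x * y \<in> R n" using mult_component[of x "Suc k" y 1] less[of "Suc k"] assms 3 by auto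
    qed
    from span_minimal[OF this subspace_component] show ?thesis using 3 by simp
  qed
qed

lemma filtration_sum:
  assumes "x \<in> filtration V m"
  shows "\<exists>g. (\<forall>i\<le>m. g i \<in> space_power V i) \<and> x = (\<Sum>i\<le>m. g i)"
  using assms unfolding filtration_def
proof (induction rule: span_induct_alt)
  case base
  show ?case using subspace_0[OF subspace_space_power] by (intro exI[of _ "\<lambda>_. 0"]) simp
next
  case (step c y z)
  obtain g where g: "\<And>i. i \<le> m \<Longrightarrow> g i \<in> space_power V i" "z = (\<Sum>i\<le>m. g i)" using step by blast
  obtain j where j: "j \<le> m" "y \<in> space_power V j" using step by blast
  have "(\<Sum>i\<le>m. if i = j then scale c y else 0) = scale c y" using j(1) by simp
  then have "scale c y + z = (\<Sum>i\<le>m. g i + (if i = j then scale c y else 0))"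
    unfolding sum.distrib g(2) by (simp only: add.commute)
  moreover have "g i + (if i = j then scale c y else 0) \<in> space_power V i" if "i \<le> m" for i
  proof (rule subspace_add[OF subspace_space_power g(1)[OF that]])
    show "(if i = j then scale c y else 0) \<in> space_power V i"
      using subspace_scale[OF subspace_space_power j(2)] subspace_0[OF subspace_space_power] by simp
  qed
  ultimately show ?case
    by (intro exI[of _ "\<lambda>i. g i + (if i = j then scale c y else 0)"]) simp
qed

text \<open>Since \<open>V\<close> is concentrated in degree one, its \<open>i\<close>-th power lies in degree \<open>i\<close>. An element of
  degree \<open>n\<close>, written as a sum of elements of these powers, therefore equals its summand in the
  \<open>n\<close>-th power.\<close>

lemma component_subset_filtration:
  assumes "generates V" "V \<subseteq> R 1" shows "R n \<subseteq> filtration V n"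
proof
  fix x assume x: "x \<in> R n"
  obtain m where "x \<in> filtration V m" using filtration_exhausts[OF assms(1)] by blast
  then obtain g where g: "\<And>i. i \<le> m \<Longrightarrow> g i \<in> space_power V i" "x = (\<Sum>i\<le>m. g i)"
    using filtration_sum by blast
  have "x = (if n \<in> {..m} then g n else 0)"
    by (rule homogeneous_component_unique[OF _ _ x g(2)])
      (use g(1) space_power_homogeneous[OF assms(2)] in auto)
  then have "x \<in> space_power V n" using g(1)[of n] subspace_0[OF subspace_space_power] by (auto split: if_splits)
  then show "x \<in> filtration V n" using space_power_filtration by blast
qed

lemma dim_component_le_growth:
  assumes "finite_dim V" "generates V" "V \<subseteq> R 1"
  shows "dim (R n) \<le> growth V n"
proof -
  obtain C where C: "finite C" "filtration V n = span C" using finite_span_filtration[OF assms(1)] by blast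
  have "dim (R n) \<le> dim (filtration V n)"
    using dim_mono_finite[OF _ C(1)] component_subset_filtration[OF assms(2,3)] C(2) by metis
  then show ?thesis by (simp add: growth_filtration)
qed

end

lemma (in fg_graded_algebra) dim_component_polynomially_bounded:
  assumes "GKdim < \<infinity>"
  obtains c :: real where "\<forall>\<^sub>F n in sequentially. real (dim (R n)) \<le> real n powr c"
proof -
  obtain X where X: "finite X" "X \<subseteq> R 1" "generates X" using finitely_generated_degree_1 by blast
  have V: "generating_space (span X)" by (rule generating_space_span[OF X(1,3)])
  have V': "finite_dim (span X)" "generates (span X)" using V by (auto simp: generating_space_def)
  have V1: "span X \<subseteq> R 1" by (rule span_minimal[OF X(2) subspace_component])
  have "GKdim_wrt (span X) \<noteq> \<infinity>" using assms unfolding GKdim_eq[OF V] by (rule less_imp_neq)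
  then obtain k :: nat where "GKdim_wrt (span X) < ereal (real k)"
    unfolding less_PInf_Ex_of_nat by (rule exE)
  then obtain c where "GKdim_wrt (span X) < ereal c" by (rule that)
  then have "\<forall>\<^sub>F n in sequentially. ereal (log (real n) (real (growth (span X) n))) < ereal c"
    unfolding GKdim_wrt_def by (rule Limsup_lessD)
  then have "\<forall>\<^sub>F n in sequentially. real (dim (R n)) \<le> real n powr c"
    using eventually_ge_at_top[of 2]
  proof eventually_elim
    case (elim n)
    have "1 < real n" using elim(2) by simp
    moreover have "0 < real (growth (span X) n)" using growth_pos[OF V'(1)] by (simp only: of_nat_0_less_iff)
    moreover have "log (real n) (real (growth (span X) n)) < c" using elim(1) by (simp only: less_ereal.simps)
    ultimately have "real (growth (span X) n) < real n powr c" by (simp only: log_less_iff)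
    moreover have "real (dim (R n)) \<le> real (growth (span X) n)"
      using dim_component_le_growth[OF V' V1] by (simp only: of_nat_le_iff)
    ultimately show ?case by linarith
  qed
  then show thesis by (rule that)
qed

section \<open>The Hilbert series\<close>

lemma conv_radius_ge_1_of_polynomial_growth:
  fixes a :: "nat \<Rightarrow> complex"
  assumes "\<forall>\<^sub>F n in sequentially. norm (a n) \<le> real n powr c"
  shows "conv_radius a \<ge> 1"
proof (rule conv_radius_geI_ex')
  fix r :: real assume r: "0 < r" "ereal r < 1"
  have "r < 1" using r by simp
  with r(1) have "(\<lambda>n. real n powr c * r ^ n) \<in> O(\<lambda>n. real n powr -2)" by real_asymp
  moreover have "summable (\<lambda>n. norm (real n powr -2))" by (simp add: summable_real_powr_iff)
  ultimately have "summable (\<lambda>n. real n powr c * r ^ n)"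
    by (rule summable_comparison_test_bigo[rotated])
  moreover have "\<forall>\<^sub>F n in sequentially. norm (a n * of_real r ^ n) \<le> real n powr c * r ^ n"
    using assms
  proof eventually_elim
    case (elim n)
    then show ?case using r by (simp add: norm_mult norm_power mult_right_mono)
  qed
  ultimately show "summable (\<lambda>n. a n * of_real r ^ n)" by (rule summable_comparison_test_ev[rotated])
qed

theorem theorem6:
  fixes scale :: "'k::field \<Rightarrow> 'a::ring \<Rightarrow> 'a"
    and R :: "nat \<Rightarrow> 'a set"
  assumes "fg_graded_algebra scale R"
    and "algebra_over.GKdim scale < \<infinity>"
  shows "rational_series (graded_algebra.Hilbert_series scale R) \<or>
    transcendental_series (graded_algebra.Hilbert_series scale R)"
proof -
  interpret fg_graded_algebra scale R by fact
  obtain c where c: "\<forall>\<^sub>F n in sequentially. real (dim (R n)) \<le> real n powr c"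
    by (rule dim_component_polynomially_bounded[OF assms(2)])
  have "fps_conv_radius (complex_fps Hilbert_series) \<ge> 1"
    unfolding fps_conv_radius_def
    by (rule conv_radius_ge_1_of_polynomial_growth) (use c in \<open>simp add: Hilbert_series_def\<close>)
  moreover have "fps_nth Hilbert_series n \<in> \<int>" for n by (simp add: Hilbert_series_def)
  ultimately show ?thesis using integral_algebraic_series_rational by blast
qed

end
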